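(* Let $G=(N,E)$ be a finite directed graph, $T\ge1$ an integer, $\Gamma\subseteq\mathcal P(N\times N)$, $g:\mathbb R^{E^T}_{\ge0}\to\mathbb R^{E^T}_{\ge0}$, and $q'\in\mathcal P(\operatorname{Path}(G^T))$. Then $q'\in\operatorname{WE}(G^T,\Gamma^T,g)$ if and only if $\Omega[q']\in\operatorname{WE}(G^{T,\Omega},\Gamma^{T,\Omega},g)$.
   Context: Graphs and paths. A directed graph is $G=(N,E)$ with $N$ finite and $E\subseteq N\times N$. A path is a finite list of nodes $\omega=(x_0,\dots,x_\ell)$, $\ell\ge0$, with $(x_{k-1},x_k)\in E$; $\omega^-=x_0$, $\omega^+=x_\ell$; $\operatorname{Path}(G)$ is the set of paths. For $\xi:E\to[0,\infty)$, $L_\xi(\omega)=\sum_{e\in\omega}\xi(e)$ with multiplicity, $d_\xi(x,y)=\min\{L_\xi(\omega):\omega^-=x,\omega^+=y\}$ ($+\infty$ if there is no such path), and $\operatorname{Geod}(G,\xi)$ is the set of $\omega$ with $L_\xi(\omega)=d_\xi(\omega^-,\omega^+)$. $\mathcal P(X)$ denotes probability distributions on a countable set $X$; $\{q>0\}$ is the support. Profiles. For $q\in\mathcal P(\operatorname{Path}(G))$: transport plan $\gamma[q](x,y)=\sum_{\omega^-=x,\omega^+=y}q(\omega)$; edge flow $i[q](e)=\sum_{\omega\ni e}q(\omega)$. For a cost $g:\mathbb R^E_{\ge0}\to\mathbb R^E_{\ge0}$ and $\Gamma\subseteq\mathcal P(N\times N)$, $\operatorname{WE}(G,\Gamma,g)$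 (efficient Wardrop equilibria) is the set of $q\in\mathcal P(\operatorname{Path}(G))$ with $\{q>0\}\subseteq\operatorname{Geod}(G,g(i[q]))$ and $\gamma[q]\in\operatorname{argmin}_{\gamma\in\Gamma}\sum_{x,y}d_{g(i[q])}(x,y)\gamma(x,y)$ (with $\infty\cdot0=0$). The marginals of $\gamma$ are $\pi^-[\gamma](x)=\sum_y\gamma(x,y)$ and $\pi^+[\gamma](y)=\sum_x\gamma(x,y)$. Extended graphs. $N^T=N\times\{0,\dots,T\}$; $E^T$ consists of the edges $((x,t-1),(y,t))$ for $(x,y)\in E$, $t\in\{1,\dots,T\}$; $G^T=(N^T,E^T)$. With a symbol $\Omega$, $N^\Omega=N\times\{\Omega\}$, $E^\Omega=\{((x,t),(x,\Omega)):x\in N,\ 1\le t\le T\}$, $G^{T,\Omega}=(N^T\cup N^\Omega,E^T\cup E^\Omega)=:(N^{T,\Omega},E^{T,\Omega})$. Extended plans. $\Gamma^T$ is the set of $\gamma\in\mathcal P(N^T\times N^T)$ with $\{\pi^-[\gamma]>0\}\subseteq N\times\{0\}$, $\{\pi^+[\gamma]>0\}\subseteq N\times\{1,\dots,T\}$, and $\pi[\gamma]\in\Gamma$, where $\pi[\gamma](x,y)=\sum_{t,s=0}^T\gamma((x,t),(y,s))$. $\Gamma^{T,\Omega}=\{\iota[\gamma]:\gamma\in\Gamma\}\subseteq\mathcal P(N^{T,\Omega}\times N^{T,\Omega})$, where $\iota[\gamma]((x,t),(y,s))=\gamma(x,y)$ if $(t,s)=(0,\Omega)$ and $0$ otherwise.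 Extended cost and profile. $g$ is extended to $\mathbb R^{E^{T,\Omega}}_{\ge0}$ by $g_e(i)=g_e(i|_{E^T})$ if $e\in E^T$ and $g_e(i)=0$ if $e\in E^\Omega$. A path $\omega'\in\operatorname{Path}(G^T)$ with final node $(x,t)$ is extended to the path $\Omega(\omega')\in\operatorname{Path}(G^{T,\Omega})$ obtained by appending the one additional edge $((x,t),(x,\Omega))$, so that it ends in $N^\Omega$. The extension $\Omega[q']\in\mathcal P(\operatorname{Path}(G^{T,\Omega}))$ of $q'$ is $\Omega[q'](\omega)=q'(\omega')$ if $\omega=\Omega(\omega')$, and $0$ otherwise. *)

theory Defs
  imports "HOL-Probability.Probability" "Graph_Theory.Graph_Theory"
begin

text \<open>
  Probability distributions on a countable set \<open>X\<close> are rendered as \<open>pmf\<close>s supported in \<open>X\<close>; the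
  transport plan, the projection \<open>\<pi>\<close>, the embedding \<open>\<iota>\<close> and the extension \<open>\<Omega>[q']\<close>
  are push-forwards. Each comes with a lemma giving its pointwise formula.
\<close>

definition distributions :: "'v set \<Rightarrow> 'v pmf set"
  where "distributions X = {p. set_pmf p \<subseteq> X}"

text \<open>The orthant of nonnegative vectors indexed by \<open>A\<close>, as functions extensional on \<open>A\<close>.\<close>

definition nonneg_vectors :: "'e set \<Rightarrow> ('e \<Rightarrow> real) set"
  where "nonneg_vectors A = A \<rightarrow>\<^sub>E {0..}"


section \<open>Paths and geodesics\<close>

definition Path :: "'v pair_pre_digraph \<Rightarrow> 'v list set"
  where "Path G = {\<omega>. vwalk \<omega> (with_proj G)}"

definition path_cost :: "('v \<times> 'v \<Rightarrow> real) \<Rightarrow> 'v list \<Rightarrow> real"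
  where "path_cost \<xi> \<omega> = (\<Sum>e\<leftarrow>vwalk_arcs \<omega>. \<xi> e)"

text \<open>
  In a finite graph with nonnegative \<open>\<xi>\<close> the infimum is a minimum whenever \<open>x\<close> and \<open>y\<close>
  are joined by a path; otherwise it is the infimum of the empty set, i.e. \<open>\<infinity>\<close>.
\<close>

definition path_dist :: "'v pair_pre_digraph \<Rightarrow> ('v \<times> 'v \<Rightarrow> real) \<Rightarrow> 'v \<Rightarrow> 'v \<Rightarrow> ereal"
  where "path_dist G \<xi> x y =
    (INF \<omega> \<in> {\<omega> \<in> Path G. hd \<omega> = x \<and> last \<omega> = y}. ereal (path_cost \<xi> \<omega>))"

definition Geod :: "'v pair_pre_digraph \<Rightarrow> ('v \<times> 'v \<Rightarrow> real) \<Rightarrow> 'v list set"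
  where "Geod G \<xi> =
    {\<omega> \<in> Path G. ereal (path_cost \<xi> \<omega>) = path_dist G \<xi> (hd \<omega>) (last \<omega>)}"


section \<open>Profiles and efficient Wardrop equilibria\<close>

definition transport_plan :: "'v list pmf \<Rightarrow> ('v \<times> 'v) pmf"
  where "transport_plan q = map_pmf (\<lambda>\<omega>. (hd \<omega>, last \<omega>)) q"

text \<open>A path using an edge several times counts only once.\<close>

definition edge_flow :: "'v pair_pre_digraph \<Rightarrow> 'v list pmf \<Rightarrow> 'v \<times> 'v \<Rightarrow> real"
  where "edge_flow G q =
    restrict (\<lambda>e. measure_pmf.prob q {\<omega>. e \<in> set (vwalk_arcs \<omega>)}) (parcs G)"

text \<open>In \<open>ereal\<close> the convention \<open>\<infinity> * 0 = 0\<close> holds.\<close>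

definition transport_cost ::
    "'v pair_pre_digraph \<Rightarrow> ('v \<times> 'v \<Rightarrow> real) \<Rightarrow> ('v \<times> 'v) pmf \<Rightarrow> ereal"
  where "transport_cost G \<xi> \<gamma> =
    (\<Sum>(x, y) \<in> pverts G \<times> pverts G. path_dist G \<xi> x y * ereal (pmf \<gamma> (x, y)))"

definition WE :: "'v pair_pre_digraph \<Rightarrow> ('v \<times> 'v) pmf set \<Rightarrow>
    (('v \<times> 'v \<Rightarrow> real) \<Rightarrow> ('v \<times> 'v \<Rightarrow> real)) \<Rightarrow> 'v list pmf set"
  where "WE G \<Gamma> g = {q \<in> distributions (Path G).
    set_pmf q \<subseteq> Geod G (g (edge_flow G q)) \<and>
    is_arg_min (transport_cost G (g (edge_flow G q))) (\<lambda>\<gamma>. \<gamma> \<in> \<Gamma>) (transport_plan q)}"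

lemma pmf_transport_plan:
  "pmf (transport_plan q) (x, y) = (\<Sum>\<^sub>\<infinity>\<omega> | hd \<omega> = x \<and> last \<omega> = y. pmf q \<omega>)"
proof -
  have "pmf (transport_plan q) (x, y) = measure_pmf.prob q {\<omega>. hd \<omega> = x \<and> last \<omega> = y}"
    unfolding transport_plan_def pmf_map by (rule arg_cong[where f = "measure _"]) auto
  then show ?thesis
    by (simp add: measure_pmf_conv_infsetsum infsetsum_infsum pmf_abs_summable)
qed

lemma edge_flow_eq_infsum:
  "e \<in> parcs G \<Longrightarrow> edge_flow G q e = (\<Sum>\<^sub>\<infinity>\<omega> | e \<in> set (vwalk_arcs \<omega>). pmf q \<omega>)"
  by (simp add: edge_flow_def measure_pmf_conv_infsetsum infsetsum_infsum pmf_abs_summable)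


section \<open>Extended graphs\<close>

text \<open>
  Both extended graphs share one node type, so that the time-expanded graph is literally a subgraph
  of the one with the additional layer \<open>Omega\<close>.
\<close>

datatype layer = Time nat | Omega

definition time_nodes :: "'v pair_pre_digraph \<Rightarrow> nat \<Rightarrow> ('v \<times> layer) set"
  where "time_nodes G T = pverts G \<times> Time ` {0..T}"

definition time_edges :: "'v pair_pre_digraph \<Rightarrow> nat \<Rightarrow> (('v \<times> layer) \<times> ('v \<times> layer)) set"
  where "time_edges G T =
    {((x, Time (t - 1)), (y, Time t)) | x y t. (x, y) \<in> parcs G \<and> t \<in> {1..T}}"

definition time_graph :: "'v pair_pre_digraph \<Rightarrow> nat \<Rightarrow> ('v \<times> layer) pair_pre_digraph"
  where "time_graph G T = \<lparr>pverts = time_nodes G T, parcs = time_edges G T\<rparr>"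

definition omega_nodes :: "'v pair_pre_digraph \<Rightarrow> ('v \<times> layer) set"
  where "omega_nodes G = pverts G \<times> {Omega}"

definition omega_edges :: "'v pair_pre_digraph \<Rightarrow> nat \<Rightarrow> (('v \<times> layer) \<times> ('v \<times> layer)) set"
  where "omega_edges G T = {((x, Time t), (x, Omega)) | x t. x \<in> pverts G \<and> t \<in> {1..T}}"

definition omega_graph :: "'v pair_pre_digraph \<Rightarrow> nat \<Rightarrow> ('v \<times> layer) pair_pre_digraph"
  where "omega_graph G T =
    \<lparr>pverts = time_nodes G T \<union> omega_nodes G, parcs = time_edges G T \<union> omega_edges G T\<rparr>"


section \<open>Extended plans\<close>

definition project_plan :: "(('v \<times> layer) \<times> ('v \<times> layer)) pmf \<Rightarrow> ('v \<times> 'v) pmf"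
  where "project_plan \<gamma> = map_pmf (map_prod fst fst) \<gamma>"

definition time_plans :: "'v pair_pre_digraph \<Rightarrow> nat \<Rightarrow> ('v \<times> 'v) pmf set \<Rightarrow>
    (('v \<times> layer) \<times> ('v \<times> layer)) pmf set"
  where "time_plans G T \<Gamma> = {\<gamma> \<in> distributions (time_nodes G T \<times> time_nodes G T).
    set_pmf (map_pmf fst \<gamma>) \<subseteq> pverts G \<times> {Time 0} \<and>
    set_pmf (map_pmf snd \<gamma>) \<subseteq> pverts G \<times> Time ` {1..T} \<and>
    project_plan \<gamma> \<in> \<Gamma>}"

definition embed_plan :: "('v \<times> 'v) pmf \<Rightarrow> (('v \<times> layer) \<times> ('v \<times> layer)) pmf"
  where "embed_plan \<gamma> = map_pmf (\<lambda>(x, y). ((x, Time 0), (y, Omega))) \<gamma>"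

definition omega_plans :: "('v \<times> 'v) pmf set \<Rightarrow> (('v \<times> layer) \<times> ('v \<times> layer)) pmf set"
  where "omega_plans \<Gamma> = embed_plan ` \<Gamma>"

lemma pmf_project_plan:
  assumes "\<gamma> \<in> distributions (time_nodes G T \<times> time_nodes G T)"
  shows "pmf (project_plan \<gamma>) (x, y) = (\<Sum>t=0..T. \<Sum>s=0..T. pmf \<gamma> ((x, Time t), (y, Time s)))"
proof -
  let ?f = "\<lambda>(t, s). ((x, Time t), (y, Time s))"
  let ?A = "?f ` ({0..T} \<times> {0..T})"
  have "pmf (project_plan \<gamma>) (x, y) = measure_pmf.prob \<gamma> (map_prod fst fst -` {(x, y)} \<inter> set_pmf \<gamma>)"
    by (simp add: project_plan_def pmf_map measure_Int_set_pmf)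
  also have "map_prod fst fst -` {(x, y)} \<inter> set_pmf \<gamma> = ?A \<inter> set_pmf \<gamma>"
    using assms by (fastforce simp: distributions_def time_nodes_def image_iff)
  also have "measure_pmf.prob \<gamma> (?A \<inter> set_pmf \<gamma>) = sum (pmf \<gamma>) ?A"
    by (simp add: measure_Int_set_pmf measure_measure_pmf_finite)
  also have "\<dots> = (\<Sum>p\<in>{0..T} \<times> {0..T}. pmf \<gamma> (?f p))"
    by (subst sum.reindex) (auto simp: inj_on_def)
  also have "\<dots> = (\<Sum>t=0..T. \<Sum>s=0..T. pmf \<gamma> ((x, Time t), (y, Time s)))"
    by (simp add: sum.cartesian_product case_prod_unfold)
  finally show ?thesis .
qed

lemma pmf_embed_plan:
  "pmf (embed_plan \<gamma>) ((x, t), (y, s)) = (if (t, s) = (Time 0, Omega) then pmf \<gamma> (x, y) else 0)"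
proof (cases "(t, s) = (Time 0, Omega)")
  case True
  have inj: "inj (\<lambda>(x :: 'a, y :: 'a). ((x, Time 0), (y, Omega)))"
    by (auto simp: inj_on_def)
  show ?thesis
    using pmf_map_inj'[OF inj, of \<gamma> "(x, y)"] True by (simp add: embed_plan_def)
next
  case False
  then show ?thesis
    unfolding embed_plan_def by (subst pmf_map_outside) auto
qed


section \<open>Extended cost and profile\<close>

definition extend_cost :: "'v pair_pre_digraph \<Rightarrow> nat \<Rightarrow>
    ((('v \<times> layer) \<times> ('v \<times> layer) \<Rightarrow> real) \<Rightarrow> (('v \<times> layer) \<times> ('v \<times> layer) \<Rightarrow> real)) \<Rightarrow>
    (('v \<times> layer) \<times> ('v \<times> layer) \<Rightarrow> real) \<Rightarrow> (('v \<times> layer) \<times> ('v \<times> layer) \<Rightarrow> real)"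
  where "extend_cost G T g i =
    restrict (\<lambda>e. if e \<in> time_edges G T then g (restrict i (time_edges G T)) e else 0)
      (time_edges G T \<union> omega_edges G T)"

text \<open>
  A trivial path sitting in layer \<open>Time 0\<close> is sent to a list that is not a path of
  \<open>omega_graph G T\<close>, since there is no edge from layer \<open>Time 0\<close> to \<open>Omega\<close>. Hence a
  profile charging such a path has an extension that is not a distribution on
  \<open>Path (omega_graph G T)\<close>, and in particular not an equilibrium.
\<close>

definition extend_path :: "('v \<times> layer) list \<Rightarrow> ('v \<times> layer) list"
  where "extend_path \<omega> = \<omega> @ [(fst (last \<omega>), Omega)]"

definition extend_profile :: "('v \<times> layer) list pmf \<Rightarrow> ('v \<times> layer) list pmf"
  where "extend_profile q = map_pmf extend_path q"

lemma pmf_extend_profile: "pmf (extend_profile q) (extend_path \<omega>) = pmf q \<omega>"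
  unfolding extend_profile_def by (rule pmf_map_inj') (auto simp: inj_on_def extend_path_def)

lemma pmf_extend_profile_eq_0:
  "q \<in> distributions (Path (time_graph G T)) \<Longrightarrow> \<omega> \<notin> extend_path ` Path (time_graph G T) \<Longrightarrow>
    pmf (extend_profile q) \<omega> = 0"
  unfolding extend_profile_def by (rule pmf_map_outside) (auto simp: distributions_def)

end

theory Submission
  imports Defs
begin

text \<open>
  Since the edges into the layer \<open>Omega\<close> are free, the distance from \<open>u\<close> to \<open>(y, Omega)\<close> is the
  minimum over the arrival times \<open>t\<close> of the distance from \<open>u\<close> to \<open>(y, Time t)\<close>. Choosing
  optimal arrival times and forgetting arrival times thus translate the two transport problems into
  one another with equal minimal costs. A plan on the time-expanded graph with finite cost is
  optimal only if almost every pair in it uses an optimal arrival time, which is exactly what makes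
  the extension of a geodesic a geodesic.
\<close>

section \<open>Transport costs as integrals\<close>

text \<open>Integrals against \<gamma> make costs comparable pointwise on the support of \<gamma>.
  Nonnegativity makes the passage through \<open>ennreal\<close> lossless, and \<open>ereal\<close>
  and \<open>ennreal\<close> share the convention that infinity times zero is zero.\<close>

lemma transport_cost_eq_nn_integral:
  assumes "finite (pverts G)"
    and "\<And>x y. 0 \<le> path_dist G \<xi> x y"
    and "\<gamma> \<in> distributions (pverts G \<times> pverts G)"
  shows "transport_cost G \<xi> \<gamma> =
    enn2ereal (\<integral>\<^sup>+p. e2ennreal (path_dist G \<xi> (fst p) (snd p)) \<partial>measure_pmf \<gamma>)"
proof -
  let ?A = "pverts G \<times> pverts G"
  have "(\<integral>\<^sup>+p. e2ennreal (path_dist G \<xi> (fst p) (snd p)) \<partial>measure_pmf \<gamma>) =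
      (\<Sum>p\<in>?A. e2ennreal (path_dist G \<xi> (fst p) (snd p)) * ennreal (pmf \<gamma> p))"
    using assms by (intro nn_integral_measure_pmf_support) (auto simp: distributions_def)
  then have "enn2ereal (\<integral>\<^sup>+p. e2ennreal (path_dist G \<xi> (fst p) (snd p)) \<partial>measure_pmf \<gamma>) =
      (\<Sum>p\<in>?A. enn2ereal (e2ennreal (path_dist G \<xi> (fst p) (snd p)) * ennreal (pmf \<gamma> p)))"
    by simp
  also have "\<dots> = (\<Sum>p\<in>?A. path_dist G \<xi> (fst p) (snd p) * ereal (pmf \<gamma> p))"
    using assms(2)
    by (intro sum.cong refl) (simp add: times_ennreal.rep_eq enn2ereal_e2ennreal)
  finally show ?thesis
    by (simp add: transport_cost_def case_prod_unfold)
qed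

section \<open>Supports of plans and the relation between embedding and projection\<close>

lemma set_transport_plan:
  "set_pmf (transport_plan q) = (\<lambda>\<omega>. (hd \<omega>, last \<omega>)) ` set_pmf q"
  by (simp add: transport_plan_def)

lemma project_embed_plan [simp]: "project_plan (embed_plan \<gamma>) = \<gamma>"
  by (simp add: project_plan_def embed_plan_def pmf.map_comp o_def case_prod_unfold)

lemma embed_project_plan:
  "embed_plan (project_plan \<gamma>) =
    map_pmf (\<lambda>p. ((fst (fst p), Time 0), (fst (snd p), Omega))) \<gamma>"
  by (simp add: project_plan_def embed_plan_def pmf.map_comp o_def case_prod_unfold)

lemma time_planE:
  assumes "\<gamma> \<in> time_plans G T \<Gamma>" "p \<in> set_pmf \<gamma>"
  obtains x y t where "p = ((x, Time 0), (y, Time t))" "x \<in> pverts G" "y \<in> pverts G" "t \<in> {1..T}"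
proof -
  from assms have "fst p \<in> pverts G \<times> {Time 0}" "snd p \<in> pverts G \<times> Time ` {1..T}"
    unfolding time_plans_def set_map_pmf by blast+
  then show thesis
    using that by (cases p) auto
qed

section \<open>Paths in the extended graph\<close>

lemma Path_time_graph:
  "\<omega> \<in> Path (time_graph G T) \<longleftrightarrow>
    \<omega> \<noteq> [] \<and> set \<omega> \<subseteq> time_nodes G T \<and> set (vwalk_arcs \<omega>) \<subseteq> time_edges G T"
  by (auto simp: Path_def vwalk_def time_graph_def)

lemma Path_omega_graph:
  "\<omega> \<in> Path (omega_graph G T) \<longleftrightarrow>
    \<omega> \<noteq> [] \<and> set \<omega> \<subseteq> time_nodes G T \<union> omega_nodes G \<and>
      set (vwalk_arcs \<omega>) \<subseteq> time_edges G T \<union> omega_edges G T"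
  by (auto simp: Path_def vwalk_def omega_graph_def)

lemma hd_extend_path: "\<omega> \<noteq> [] \<Longrightarrow> hd (extend_path \<omega>) = hd \<omega>"
  by (simp add: extend_path_def)

lemma last_extend_path: "last (extend_path \<omega>) = (fst (last \<omega>), Omega)"
  by (simp add: extend_path_def)

lemma vwalk_arcs_extend_path:
  "\<omega> \<noteq> [] \<Longrightarrow> vwalk_arcs (extend_path \<omega>) = vwalk_arcs \<omega> @ [(last \<omega>, (fst (last \<omega>), Omega))]"
  by (simp add: extend_path_def vwalk_arcs_append)

text \<open>Only the appended arc matters. Its head lies in \<open>Omega\<close>, so it is no time
  edge, and \<open>omega_edges\<close> starts at layer 1; a trivial path in layer 0 is what gets
  excluded.\<close>

lemma extend_path_in_Path_iff:
  assumes "\<omega> \<in> Path (time_graph G T)"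
  shows "extend_path \<omega> \<in> Path (omega_graph G T) \<longleftrightarrow> snd (last \<omega>) \<in> Time ` {1..T}"
proof -
  have ne: "\<omega> \<noteq> []" and "last \<omega> \<in> time_nodes G T"
    using assms last_in_set by (auto simp: Path_time_graph)
  then have "(last \<omega>, (fst (last \<omega>), Omega)) \<in> omega_edges G T \<longleftrightarrow> snd (last \<omega>) \<in> Time ` {1..T}"
    and "(fst (last \<omega>), Omega) \<in> omega_nodes G"
    by (cases "last \<omega>"; fastforce simp: omega_edges_def omega_nodes_def time_nodes_def)+
  moreover have "(last \<omega>, (fst (last \<omega>), Omega)) \<notin> time_edges G T"
    by (auto simp: time_edges_def)
  ultimately show ?thesis
    using assms ne
    by (auto simp: Path_time_graph Path_omega_graph vwalk_arcs_extend_path)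
       (auto simp: extend_path_def)
qed

text \<open>No arc leaves \<open>Omega\<close>, so a path that does not end there never visits it.
  The induction peels off the first node: once the tail stays in time layers, the arc into it must
  be a time edge.\<close>

lemma omega_path_to_time_layer:
  assumes "\<omega> \<in> Path (omega_graph G T)" "snd (last \<omega>) \<noteq> Omega"
  shows "\<omega> \<in> Path (time_graph G T)"
  using assms
proof (induction \<omega> rule: vwalk_arcs.induct)
  case (3 u v \<omega>)
  then have *: "v # \<omega> \<in> Path (time_graph G T)"
    by (auto simp: Path_omega_graph)
  then have "snd v \<noteq> Omega"
    by (auto simp: Path_time_graph time_nodes_def)
  then have "(u, v) \<in> time_edges G T" "u \<in> time_nodes G T"
    using "3.prems" by (auto simp: Path_omega_graph omega_edges_def time_edges_def omega_nodes_def)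
  then show ?case
    using * by (auto simp: Path_time_graph)
qed (auto simp: Path_omega_graph Path_time_graph omega_nodes_def)

text \<open>Differing end layers force at least one arc. The last one enters \<open>Omega\<close>,
  hence preserves the base node, and what precedes it ends in a time layer.\<close>

lemma omega_path_is_extension:
  assumes "\<omega> \<in> Path (omega_graph G T)" "snd (hd \<omega>) \<noteq> Omega" "snd (last \<omega>) = Omega"
  obtains \<omega>' where "\<omega>' \<in> Path (time_graph G T)" "\<omega> = extend_path \<omega>'"
proof -
  obtain \<omega>' v where \<omega>: "\<omega> = \<omega>' @ [v]"
    using assms(1) by (cases \<omega> rule: rev_cases) (auto simp: Path_omega_graph)
  have ne: "\<omega>' \<noteq> []"
    using assms(2,3) by (auto simp: \<omega>)
  then have v: "snd v = Omega" and arc: "(last \<omega>', v) \<in> time_edges G T \<union> omega_edges G T"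
    using assms by (auto simp: \<omega> Path_omega_graph vwalk_arcs_append)
  then have eq: "v = (fst (last \<omega>'), Omega)" and "snd (last \<omega>') \<noteq> Omega"
    by (auto simp: time_edges_def omega_edges_def)
  moreover have "\<omega>' \<in> Path (omega_graph G T)"
    using assms(1) ne by (auto simp: \<omega> Path_omega_graph vwalk_arcs_append)
  ultimately show thesis
    using that omega_path_to_time_layer[of \<omega>' G T] by (simp add: \<omega> extend_path_def)
qed

text \<open>This makes \<open>extend_cost\<close> evaluate \<open>g\<close> at the flow of the
  original profile, so that both equilibrium conditions use the same costs on time edges.\<close>

lemma edge_flow_extend_profile:
  assumes "q \<in> distributions (Path (time_graph G T))"
  shows "restrict (edge_flow (omega_graph G T) (extend_profile q)) (time_edges G T) =
    edge_flow (time_graph G T) q"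
proof
  fix e
  have "measure_pmf.prob (extend_profile q) {\<omega>. e \<in> set (vwalk_arcs \<omega>)} =
      measure_pmf.prob q {\<omega>. e \<in> set (vwalk_arcs \<omega>)}" if e: "e \<in> time_edges G T"
  proof -
    \<comment> \<open>The appended arc is not a time edge; the empty list is treated separately,
      since its extension is a single node without arcs.\<close>
    have "e \<in> set (vwalk_arcs (extend_path \<omega>)) \<longleftrightarrow> e \<in> set (vwalk_arcs \<omega>)" for \<omega>
      using e by (cases "\<omega> = []")
        (auto simp: extend_path_def vwalk_arcs_append time_edges_def)
    then show ?thesis
      by (simp add: extend_profile_def vimage_def)
  qed
  then show "restrict (edge_flow (omega_graph G T) (extend_profile q)) (time_edges G T) e =
      edge_flow (time_graph G T) q e"
    by (simp add: edge_flow_def restrict_def time_graph_def omega_graph_def)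
qed

section \<open>Comparison of distances and costs\<close>

text \<open>The costs are frozen here: \<xi> and \<zeta> stand for the edge costs at the two
  equilibrium flows, and the dependence on the flow no longer enters the comparison.\<close>

locale layered_costs =
  fixes G :: "'v pair_pre_digraph" and T :: nat
    and \<xi> \<zeta> :: "('v \<times> layer) \<times> ('v \<times> layer) \<Rightarrow> real"
  assumes finite_verts: "finite (pverts G)"
    and T_pos: "T \<ge> 1"
    and nonneg: "e \<in> time_edges G T \<Longrightarrow> 0 \<le> \<xi> e"
    and time_cost: "e \<in> time_edges G T \<Longrightarrow> \<zeta> e = \<xi> e"
    and omega_cost: "e \<in> omega_edges G T \<Longrightarrow> \<zeta> e = 0"
begin

abbreviation "time_dist \<equiv> path_dist (time_graph G T) \<xi>"
abbreviation "omega_dist \<equiv> path_dist (omega_graph G T) \<zeta>"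

section \<open>Distances and geodesics in the two graphs\<close>

lemma time_dist_nonneg: "0 \<le> time_dist u v"
  unfolding path_dist_def path_cost_def
  by (intro INF_greatest) (auto simp: Path_time_graph intro!: sum_list_nonneg nonneg)

lemma omega_dist_nonneg: "0 \<le> omega_dist u v"
proof -
  have "0 \<le> \<zeta> e" if "e \<in> time_edges G T \<union> omega_edges G T" for e
    using that nonneg[of e] time_cost[of e] omega_cost[of e] by auto
  then show ?thesis
    unfolding path_dist_def path_cost_def
    by (intro INF_greatest) (auto simp: Path_omega_graph subset_iff intro!: sum_list_nonneg)
qed

lemma path_cost_extend_path:
  assumes "\<omega> \<in> Path (time_graph G T)" "snd (last \<omega>) \<in> Time ` {1..T}"
  shows "path_cost \<zeta> (extend_path \<omega>) = path_cost \<xi> \<omega>"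
proof -
  have ne: "\<omega> \<noteq> []" and "last \<omega> \<in> time_nodes G T"
    using assms last_in_set by (auto simp: Path_time_graph)
  then have "(last \<omega>, (fst (last \<omega>), Omega)) \<in> omega_edges G T"
    using assms(2) by (cases "last \<omega>") (auto simp: omega_edges_def time_nodes_def)
  moreover have "map \<zeta> (vwalk_arcs \<omega>) = map \<xi> (vwalk_arcs \<omega>)"
    using assms(1) by (intro map_cong refl time_cost) (auto simp: Path_time_graph)
  ultimately show ?thesis
    using ne by (simp add: path_cost_def vwalk_arcs_extend_path omega_cost del: map_eq_conv)
qed

text \<open>Every path arriving at time \<open>t\<close> extends by a free arc, so it competes at
  the same cost in the larger graph.\<close>

lemma omega_dist_le_time_dist:
  assumes "t \<in> {1..T}"
  shows "omega_dist u (y, Omega) \<le> time_dist u (y, Time t)"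
  unfolding path_dist_def[of "time_graph G T"]
proof (rule INF_greatest)
  fix \<omega> assume \<omega>: "\<omega> \<in> {\<omega> \<in> Path (time_graph G T). hd \<omega> = u \<and> last \<omega> = (y, Time t)}"
  then have "extend_path \<omega> \<in> Path (omega_graph G T)" "\<omega> \<noteq> []"
    using assms by (auto simp: extend_path_in_Path_iff Path_time_graph)
  then have "omega_dist u (y, Omega) \<le> ereal (path_cost \<zeta> (extend_path \<omega>))"
    using \<omega> unfolding path_dist_def
    by (intro INF_lower) (auto simp: hd_extend_path last_extend_path)
  then show "omega_dist u (y, Omega) \<le> ereal (path_cost \<xi> \<omega>)"
    using \<omega> assms by (simp add: path_cost_extend_path)
qed

text \<open>The converse bound at the best arrival time. Starting outside \<open>Omega\<close> rules
  out the trivial path at \<open>(y, Omega)\<close>, which has cost 0 and no arrival time.\<close>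

lemma omega_dist_attained:
  assumes "snd u \<noteq> Omega"
  obtains t where "t \<in> {1..T}" "time_dist u (y, Time t) \<le> omega_dist u (y, Omega)"
proof -
  let ?D = "(\<lambda>t. time_dist u (y, Time t)) ` {1..T}"
  \<comment> \<open>The minimiser \<open>t\<close> is fixed before any path is considered; each path
    then only has to be compared with its own arrival time \<open>s\<close>. The range is nonempty
    because \<open>T \<ge> 1\<close>.\<close>
  have "Min ?D \<in> ?D"
    using T_pos by (intro Min_in) auto
  then obtain t where t: "t \<in> {1..T}" "time_dist u (y, Time t) = Min ?D"
    by (metis (no_types, lifting) imageE)
  have "time_dist u (y, Time t) \<le> omega_dist u (y, Omega)"
    unfolding path_dist_def[of "omega_graph G T"]
  proof (rule INF_greatest)
    fix \<omega> assume \<omega>: "\<omega> \<in> {\<omega> \<in> Path (omega_graph G T). hd \<omega> = u \<and> last \<omega> = (y, Omega)}"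
    then obtain \<omega>' where \<omega>': "\<omega>' \<in> Path (time_graph G T)" "\<omega> = extend_path \<omega>'"
      using omega_path_is_extension[of \<omega> G T] assms by auto
    then have "snd (last \<omega>') \<in> Time ` {1..T}" "\<omega>' \<noteq> []"
      using \<omega> extend_path_in_Path_iff by (auto simp: Path_time_graph)
    moreover from this obtain s where s: "s \<in> {1..T}" "last \<omega>' = (y, Time s)"
      using \<omega> \<omega>' by (cases "last \<omega>'") (auto simp: last_extend_path)
    ultimately have "time_dist u (y, Time s) \<le> ereal (path_cost \<zeta> \<omega>)"
      using \<omega> \<omega>' unfolding path_dist_def
      by (intro INF_lower2[of \<omega>']) (auto simp: hd_extend_path path_cost_extend_path)
    moreover have "time_dist u (y, Time t) \<le> time_dist u (y, Time s)"
      using s t by simp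
    ultimately show "time_dist u (y, Time t) \<le> ereal (path_cost \<zeta> \<omega>)"
      by order
  qed
  with t that show thesis by blast
qed

text \<open>The path and its extension have the same cost, which is at least
  \<open>time_dist\<close>, which in turn is at least \<open>omega_dist\<close>. The cost equals the
  smallest of the three exactly when both inequalities are equalities.\<close>

lemma extend_path_in_Geod_iff:
  assumes "\<omega> \<in> Path (time_graph G T)" "snd (last \<omega>) \<in> Time ` {1..T}"
  shows "extend_path \<omega> \<in> Geod (omega_graph G T) \<zeta> \<longleftrightarrow>
    \<omega> \<in> Geod (time_graph G T) \<xi> \<and>
      time_dist (hd \<omega>) (last \<omega>) \<le> omega_dist (hd \<omega>) (fst (last \<omega>), Omega)"
proof -
  have "\<omega> \<noteq> []"
    using assms by (auto simp: Path_time_graph)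
  moreover have "time_dist (hd \<omega>) (last \<omega>) \<le> ereal (path_cost \<xi> \<omega>)"
    using assms(1) unfolding path_dist_def by (intro INF_lower) auto
  moreover have "omega_dist (hd \<omega>) (fst (last \<omega>), Omega) \<le> time_dist (hd \<omega>) (last \<omega>)"
    using assms(2) omega_dist_le_time_dist[of _ "hd \<omega>"] by (cases "last \<omega>") auto
  ultimately show ?thesis
    using assms
    by (auto simp: Geod_def extend_path_in_Path_iff path_cost_extend_path hd_extend_path
        last_extend_path)
qed

section \<open>Costs of plans under projection, embedding and lifting\<close>

lemma transport_cost_time:
  assumes "\<gamma> \<in> time_plans G T \<Gamma>"
  shows "transport_cost (time_graph G T) \<xi> \<gamma> =
    enn2ereal (\<integral>\<^sup>+p. e2ennreal (time_dist (fst p) (snd p)) \<partial>measure_pmf \<gamma>)"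
  using assms finite_verts
  by (intro transport_cost_eq_nn_integral time_dist_nonneg)
     (auto simp: time_graph_def time_nodes_def time_plans_def)

lemma transport_cost_omega:
  assumes "\<gamma> \<in> distributions (pverts G \<times> pverts G)"
  shows "transport_cost (omega_graph G T) \<zeta> (embed_plan \<gamma>) =
    enn2ereal (\<integral>\<^sup>+p. e2ennreal (omega_dist (fst p, Time 0) (snd p, Omega)) \<partial>measure_pmf \<gamma>)"
proof -
  have "transport_cost (omega_graph G T) \<zeta> (embed_plan \<gamma>) =
      enn2ereal (\<integral>\<^sup>+p. e2ennreal (omega_dist (fst p) (snd p)) \<partial>measure_pmf (embed_plan \<gamma>))"
    using assms finite_verts
    by (intro transport_cost_eq_nn_integral omega_dist_nonneg)
       (auto simp: omega_graph_def time_nodes_def omega_nodes_def distributions_def embed_plan_def)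
  then show ?thesis
    by (simp add: embed_plan_def case_prod_unfold)
qed

text \<open>Pulling the integral back to \<gamma> puts both transport costs over the same measure.
  Plans start in layer 0, so resetting the start layer changes nothing on the support.\<close>

lemma transport_cost_omega_project:
  assumes "\<gamma> \<in> time_plans G T \<Gamma>"
  shows "transport_cost (omega_graph G T) \<zeta> (embed_plan (project_plan \<gamma>)) =
    enn2ereal (\<integral>\<^sup>+p. e2ennreal (omega_dist (fst p) (fst (snd p), Omega)) \<partial>measure_pmf \<gamma>)"
proof -
  have "map_prod fst fst p \<in> pverts G \<times> pverts G" if "p \<in> set_pmf \<gamma>" for p
    using assms that by (rule time_planE) simp
  then have "project_plan \<gamma> \<in> distributions (pverts G \<times> pverts G)"
    by (simp add: distributions_def project_plan_def image_subset_iff)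
  moreover have "(fst (fst p), Time 0) = fst p" if "p \<in> set_pmf \<gamma>" for p
    using assms that by (rule time_planE) simp
  ultimately show ?thesis
    by (subst transport_cost_omega)
       (auto simp: project_plan_def AE_measure_pmf_iff intro!: nn_integral_cong_AE
         arg_cong[where f = enn2ereal])
qed

lemma omega_dist_le_time_dist_on_plan:
  assumes "\<gamma> \<in> time_plans G T \<Gamma>" "p \<in> set_pmf \<gamma>"
  shows "omega_dist (fst p) (fst (snd p), Omega) \<le> time_dist (fst p) (snd p)"
  using assms by (rule time_planE) (simp add: omega_dist_le_time_dist)

lemma transport_cost_project_le:
  assumes "\<gamma> \<in> time_plans G T \<Gamma>"
  shows "transport_cost (omega_graph G T) \<zeta> (embed_plan (project_plan \<gamma>)) \<le>
    transport_cost (time_graph G T) \<xi> \<gamma>"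
  unfolding transport_cost_omega_project[OF assms] transport_cost_time[OF assms]
    less_eq_ennreal.rep_eq[symmetric]
  using omega_dist_le_time_dist_on_plan[OF assms]
  by (intro nn_integral_mono_AE) (simp add: AE_measure_pmf_iff e2ennreal_mono)

lemma transport_cost_le_project:
  assumes "\<gamma> \<in> time_plans G T \<Gamma>"
    and "\<And>u v. (u, v) \<in> set_pmf \<gamma> \<Longrightarrow> time_dist u v \<le> omega_dist u (fst v, Omega)"
  shows "transport_cost (time_graph G T) \<xi> \<gamma> \<le>
    transport_cost (omega_graph G T) \<zeta> (embed_plan (project_plan \<gamma>))"
  unfolding transport_cost_omega_project[OF assms(1)] transport_cost_time[OF assms(1)]
    less_eq_ennreal.rep_eq[symmetric]
  using assms(2) by (intro nn_integral_mono_AE) (simp add: AE_measure_pmf_iff e2ennreal_mono)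

text \<open>Converse of \<open>transport_cost_le_project\<close>: ordered integrands with equal
  finite integrals agree almost everywhere, and for a \<open>pmf\<close> this means at every point
  of the support.\<close>

lemma transport_cost_le_projectD:
  assumes \<gamma>: "\<gamma> \<in> time_plans G T \<Gamma>"
    and le: "transport_cost (time_graph G T) \<xi> \<gamma> \<le>
      transport_cost (omega_graph G T) \<zeta> (embed_plan (project_plan \<gamma>))"
    and finite_dist: "\<And>u v. (u, v) \<in> set_pmf \<gamma> \<Longrightarrow> time_dist u v < \<infinity>"
    and mem: "(u, v) \<in> set_pmf \<gamma>"
  shows "time_dist u v \<le> omega_dist u (fst v, Omega)"
proof -
  let ?D = "\<lambda>p. e2ennreal (time_dist (fst p) (snd p))"
  let ?O = "\<lambda>p. e2ennreal (omega_dist (fst p) (fst (snd p), Omega))"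
  \<comment> \<open>Finite support turns pointwise finiteness of the distances into a finite
    integral.\<close>
  have fin: "finite (set_pmf \<gamma>)"
  proof (rule finite_subset)
    show "set_pmf \<gamma> \<subseteq> time_nodes G T \<times> time_nodes G T"
      using \<gamma> by (simp add: time_plans_def distributions_def)
    show "finite (time_nodes G T \<times> time_nodes G T)"
      using finite_verts by (simp add: time_nodes_def)
  qed
  have "?D p < \<top>" if "p \<in> set_pmf \<gamma>" for p
    using finite_dist[of "fst p" "snd p"] that time_dist_nonneg[of "fst p" "snd p"]
    by (simp add: less_ennreal.rep_eq enn2ereal_e2ennreal top_ennreal.rep_eq top_ereal_def)
  then have finD: "(\<integral>\<^sup>+p. ?D p \<partial>measure_pmf \<gamma>) < \<top>"
    using fin by (simp add: nn_integral_measure_pmf_finite ennreal_mult_less_top)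
  have O_le: "AE p in measure_pmf \<gamma>. ?O p \<le> ?D p"
    using omega_dist_le_time_dist_on_plan[OF \<gamma>] by (simp add: AE_measure_pmf_iff e2ennreal_mono)
  have D_le: "(\<integral>\<^sup>+p. ?D p \<partial>measure_pmf \<gamma>) \<le> (\<integral>\<^sup>+p. ?O p \<partial>measure_pmf \<gamma>)"
    using le unfolding transport_cost_omega_project[OF \<gamma>] transport_cost_time[OF \<gamma>]
      less_eq_ennreal.rep_eq[symmetric] .
  have "(\<integral>\<^sup>+p. ?D p - ?O p \<partial>measure_pmf \<gamma>) =
      (\<integral>\<^sup>+p. ?D p \<partial>measure_pmf \<gamma>) - (\<integral>\<^sup>+p. ?O p \<partial>measure_pmf \<gamma>)"
    using finD nn_integral_mono_AE[OF O_le] O_le by (intro nn_integral_diff) auto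
  \<comment> \<open>In \<open>ennreal\<close>, \<open>\<top> - \<top>\<close> is
    \<open>\<top>\<close>, so finiteness is essential here.\<close>
  also have "\<dots> = 0"
    using D_le by (simp add: diff_eq_0_ennreal finD)
  finally have "\<forall>p\<in>set_pmf \<gamma>. ?D p - ?O p = 0"
    by (simp add: nn_integral_0_iff_AE AE_measure_pmf_iff)
  from bspec[OF this mem] have "?D (u, v) - ?O (u, v) = 0" .
  then have "?D (u, v) \<le> ?O (u, v)"
    by (simp add: diff_eq_0_iff_ennreal)
  then show ?thesis
    by (simp add: less_eq_ennreal.rep_eq enn2ereal_e2ennreal time_dist_nonneg omega_dist_nonneg)
qed

text \<open>The mass of each pair \<open>(x, y)\<close> is sent entirely to one optimal arrival time
  \<open>\<tau> x y\<close>. The resulting plan projects back to \<gamma> and is tight on its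
  support, so \<open>transport_cost_le_project\<close> applies.\<close>

lemma transport_cost_lift:
  assumes "\<gamma> \<in> \<Gamma>" "\<gamma> \<in> distributions (pverts G \<times> pverts G)"
  obtains \<gamma>' where "\<gamma>' \<in> time_plans G T \<Gamma>"
    "transport_cost (time_graph G T) \<xi> \<gamma>' \<le> transport_cost (omega_graph G T) \<zeta> (embed_plan \<gamma>)"
proof -
  have "\<exists>t. t \<in> {1..T} \<and> time_dist (x, Time 0) (y, Time t) \<le> omega_dist (x, Time 0) (y, Omega)"
    for x y
    using omega_dist_attained[of "(x, Time 0)" y] by auto
  then obtain \<tau> where \<tau>: "\<And>x y. \<tau> x y \<in> {1..T}"
    "\<And>x y. time_dist (x, Time 0) (y, Time (\<tau> x y)) \<le> omega_dist (x, Time 0) (y, Omega)"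
    by metis
  define \<gamma>' where "\<gamma>' = map_pmf (\<lambda>(x, y). ((x, Time 0), (y, Time (\<tau> x y)))) \<gamma>"
  have proj: "project_plan \<gamma>' = \<gamma>"
    by (simp add: \<gamma>'_def project_plan_def pmf.map_comp o_def case_prod_unfold)
  have "\<gamma>' \<in> time_plans G T \<Gamma>"
    unfolding time_plans_def
  proof (intro CollectI conjI)
    have "x \<in> pverts G \<and> y \<in> pverts G" if "(x, y) \<in> set_pmf \<gamma>" for x y
      using that assms(2) by (auto simp: distributions_def)
    then show "\<gamma>' \<in> distributions (time_nodes G T \<times> time_nodes G T)"
      "set_pmf (map_pmf fst \<gamma>') \<subseteq> pverts G \<times> {Time 0}"
      "set_pmf (map_pmf snd \<gamma>') \<subseteq> pverts G \<times> Time ` {1..T}"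
      using \<tau>(1) by (auto simp: \<gamma>'_def distributions_def time_nodes_def)
    show "project_plan \<gamma>' \<in> \<Gamma>"
      using assms(1) by (simp add: proj)
  qed
  moreover have "time_dist u v \<le> omega_dist u (fst v, Omega)" if "(u, v) \<in> set_pmf \<gamma>'" for u v
    using that \<tau>(2) by (auto simp: \<gamma>'_def)
  ultimately have "\<gamma>' \<in> time_plans G T \<Gamma>" "transport_cost (time_graph G T) \<xi> \<gamma>' \<le>
      transport_cost (omega_graph G T) \<zeta> (embed_plan \<gamma>)"
    using transport_cost_le_project[of \<gamma>' \<Gamma>] by (simp_all add: proj)
  then show thesis
    using that by blast
qed

end

section \<open>Equivalence of the equilibria\<close>

lemma set_extend_profile: "set_pmf (extend_profile q) = extend_path ` set_pmf q"
  by (simp add: extend_profile_def)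

text \<open>Appending the final arc sets the end layer to \<open>Omega\<close>, but
  \<open>embed_plan\<close> also writes \<open>Time 0\<close> at the start; hence the condition on
  the first node.\<close>

lemma transport_plan_extend_profile:
  assumes "\<And>\<omega>. \<omega> \<in> set_pmf q \<Longrightarrow> \<omega> \<noteq> [] \<and> snd (hd \<omega>) = Time 0"
  shows "transport_plan (extend_profile q) = embed_plan (project_plan (transport_plan q))"
  using assms
  by (auto simp: transport_plan_def extend_profile_def embed_project_plan pmf.map_comp
      hd_extend_path last_extend_path prod_eq_iff intro!: map_pmf_cong)

theorem theorem4p7:
  fixes G :: "'v pair_pre_digraph"
    and T :: nat
    and \<Gamma> :: "('v \<times> 'v) pmf set"
    and g :: "(('v \<times> layer) \<times> ('v \<times> layer) \<Rightarrow> real) \<Rightarrow> (('v \<times> layer) \<times> ('v \<times> layer) \<Rightarrow> real)"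
    and q' :: "('v \<times> layer) list pmf"
  assumes "pair_fin_digraph G"
    and "T \<ge> 1"
    and "\<Gamma> \<subseteq> distributions (pverts G \<times> pverts G)"
    and "g \<in> nonneg_vectors (time_edges G T) \<rightarrow> nonneg_vectors (time_edges G T)"
    and "q' \<in> distributions (Path (time_graph G T))"
  shows "q' \<in> WE (time_graph G T) (time_plans G T \<Gamma>) g \<longleftrightarrow>
    extend_profile q' \<in> WE (omega_graph G T) (omega_plans \<Gamma>) (extend_cost G T g)"
proof -
  define \<xi> where "\<xi> = g (edge_flow (time_graph G T) q')"
  define \<zeta> where "\<zeta> = extend_cost G T g (edge_flow (omega_graph G T) (extend_profile q'))"
  define p where "p = transport_plan q'"
  have "edge_flow (time_graph G T) q' \<in> nonneg_vectors (time_edges G T)"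
    by (auto simp: nonneg_vectors_def edge_flow_def time_graph_def)
  with assms(4) have "\<xi> \<in> nonneg_vectors (time_edges G T)"
    by (auto simp: \<xi>_def)
  interpret layered_costs G T \<xi> \<zeta>
  proof
    show "finite (pverts G)"
      using assms(1) by (simp add: pair_fin_digraph_def pair_fin_digraph_axioms_def)
    show "T \<ge> 1" by fact
    show "0 \<le> \<xi> e" if "e \<in> time_edges G T" for e
      using that \<open>\<xi> \<in> nonneg_vectors _\<close> by (auto simp: nonneg_vectors_def)
    show "\<zeta> e = \<xi> e" if "e \<in> time_edges G T" for e
      using that by (simp add: \<zeta>_def \<xi>_def extend_cost_def edge_flow_extend_profile[OF assms(5)])
    show "\<zeta> e = 0" if "e \<in> omega_edges G T" for e
      using that by (auto simp: \<zeta>_def extend_cost_def omega_edges_def time_edges_def)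
  qed
  let ?C = "transport_cost (time_graph G T) \<xi>" and ?CO = "transport_cost (omega_graph G T) \<zeta>"
  have path: "\<omega> \<in> Path (time_graph G T)" "\<omega> \<noteq> []" if "\<omega> \<in> set_pmf q'" for \<omega>
  proof -
    show "\<omega> \<in> Path (time_graph G T)"
      using that assms(5) by (auto simp: distributions_def)
    then show "\<omega> \<noteq> []"
      by (simp add: Path_time_graph)
  qed
  have WE_time: "q' \<in> WE (time_graph G T) (time_plans G T \<Gamma>) g \<longleftrightarrow>
      set_pmf q' \<subseteq> Geod (time_graph G T) \<xi> \<and> p \<in> time_plans G T \<Gamma> \<and>
      (\<forall>\<gamma>\<in>time_plans G T \<Gamma>. ?C p \<le> ?C \<gamma>)"
    using assms(5) by (auto simp: WE_def \<xi>_def p_def is_arg_min_linorder)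
  \<comment> \<open>Being supported on paths is absorbed by the geodesic condition, since geodesics
    are paths by definition.\<close>
  have WE_omega: "extend_profile q' \<in> WE (omega_graph G T) (omega_plans \<Gamma>) (extend_cost G T g) \<longleftrightarrow>
      extend_path ` set_pmf q' \<subseteq> Geod (omega_graph G T) \<zeta> \<and>
      transport_plan (extend_profile q') \<in> omega_plans \<Gamma> \<and>
      (\<forall>\<gamma>\<in>\<Gamma>. ?CO (transport_plan (extend_profile q')) \<le> ?CO (embed_plan \<gamma>))"
    by (auto simp: WE_def \<zeta>_def is_arg_min_linorder distributions_def set_extend_profile
        omega_plans_def Geod_def)
  show ?thesis
  proof
    assume "q' \<in> WE (time_graph G T) (time_plans G T \<Gamma>) g"
    then have geod: "set_pmf q' \<subseteq> Geod (time_graph G T) \<xi>" and p: "p \<in> time_plans G T \<Gamma>"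
      and opt: "\<And>\<gamma>. \<gamma> \<in> time_plans G T \<Gamma> \<Longrightarrow> ?C p \<le> ?C \<gamma>"
      unfolding WE_time by blast+
    have ends: "snd (hd \<omega>) = Time 0" "snd (last \<omega>) \<in> Time ` {1..T}" if "\<omega> \<in> set_pmf q'" for \<omega>
    proof -
      have "(hd \<omega>, last \<omega>) \<in> set_pmf p"
        using that by (simp add: p_def set_transport_plan)
      then show "snd (hd \<omega>) = Time 0" "snd (last \<omega>) \<in> Time ` {1..T}"
        using p by (auto elim!: time_planE[of p G T \<Gamma> "(hd \<omega>, last \<omega>)"])
    qed
    have p_eq: "transport_plan (extend_profile q') = embed_plan (project_plan p)"
      unfolding p_def using path(2) ends(1) by (intro transport_plan_extend_profile conjI)
    \<comment> \<open>Each competitor lifts to a time plan that is no more expensive, and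
      \<open>p\<close> is optimal among time plans.\<close>
    have opt': "?C p \<le> ?CO (embed_plan \<gamma>)" if \<gamma>: "\<gamma> \<in> \<Gamma>" for \<gamma>
    proof -
      obtain \<gamma>' where "\<gamma>' \<in> time_plans G T \<Gamma>" "?C \<gamma>' \<le> ?CO (embed_plan \<gamma>)"
        using transport_cost_lift[OF \<gamma> subsetD[OF assms(3) \<gamma>]] by blast
      with opt show ?thesis by (meson order_trans)
    qed
    have proj: "project_plan p \<in> \<Gamma>"
      using p by (simp add: time_plans_def)
    \<comment> \<open>A pair charged by \<open>p\<close> is joined by a geodesic charged by
      \<open>q'\<close>, so its distance is the real cost of that path.\<close>
    have "time_dist u v < \<infinity>" if "(u, v) \<in> set_pmf p" for u v
    proof -
      from that obtain \<omega> where "\<omega> \<in> set_pmf q'" "u = hd \<omega>" "v = last \<omega>"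
        by (auto simp: p_def set_transport_plan)
      with geod have "time_dist u v = ereal (path_cost \<xi> \<omega>)"
        by (auto simp: Geod_def)
      then show ?thesis by simp
    qed
    \<comment> \<open>Here \<open>p\<close> is compared with its own projection as a
      competitor.\<close>
    then have tight: "time_dist u v \<le> omega_dist u (fst v, Omega)" if "(u, v) \<in> set_pmf p" for u v
      using transport_cost_le_projectD[OF p opt'[OF proj]] that by blast
    have "extend_path \<omega> \<in> Geod (omega_graph G T) \<zeta>" if "\<omega> \<in> set_pmf q'" for \<omega>
      using extend_path_in_Geod_iff[OF path(1)[OF that] ends(2)[OF that]]
        tight[of "hd \<omega>" "last \<omega>"] that geod
      by (auto simp: p_def set_transport_plan)
    then have "extend_path ` set_pmf q' \<subseteq> Geod (omega_graph G T) \<zeta>"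
      by blast
    moreover have "?CO (transport_plan (extend_profile q')) \<le> ?CO (embed_plan \<gamma>)" if "\<gamma> \<in> \<Gamma>" for \<gamma>
      unfolding p_eq using transport_cost_project_le[OF p] opt'[OF that] by order
    ultimately show "extend_profile q' \<in> WE (omega_graph G T) (omega_plans \<Gamma>) (extend_cost G T g)"
      using proj unfolding WE_omega p_eq by (simp add: omega_plans_def)
  next
    assume "extend_profile q' \<in> WE (omega_graph G T) (omega_plans \<Gamma>) (extend_cost G T g)"
    then have geod: "extend_path ` set_pmf q' \<subseteq> Geod (omega_graph G T) \<zeta>"
      and opt: "\<And>\<gamma>. \<gamma> \<in> \<Gamma> \<Longrightarrow> ?CO (transport_plan (extend_profile q')) \<le> ?CO (embed_plan \<gamma>)"
      and "transport_plan (extend_profile q') \<in> omega_plans \<Gamma>"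
      unfolding WE_omega by blast+
    from this(3) obtain \<gamma> where \<gamma>: "\<gamma> \<in> \<Gamma>" "transport_plan (extend_profile q') = embed_plan \<gamma>"
      by (auto simp: omega_plans_def)
    have start: "snd (hd \<omega>) = Time 0" if "\<omega> \<in> set_pmf q'" for \<omega>
    proof -
      have "(hd (extend_path \<omega>), last (extend_path \<omega>)) \<in> set_pmf (embed_plan \<gamma>)"
        using that by (simp add: \<gamma>(2)[symmetric] set_transport_plan extend_profile_def)
      then show ?thesis
        using path(2)[OF that] by (auto simp: embed_plan_def hd_extend_path)
    qed
    \<comment> \<open>A geodesic is in particular a path, so the appended arc must exist.\<close>
    have finish: "snd (last \<omega>) \<in> Time ` {1..T}" if "\<omega> \<in> set_pmf q'" for \<omega>
      using extend_path_in_Path_iff[OF path(1)[OF that]] that geod by (auto simp: Geod_def)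
    have p_eq: "transport_plan (extend_profile q') = embed_plan (project_plan p)"
      unfolding p_def using path(2) start by (intro transport_plan_extend_profile conjI)
    then have "project_plan p = \<gamma>"
      using \<gamma>(2) by (metis project_embed_plan)
    have nodes: "hd \<omega> \<in> time_nodes G T" "last \<omega> \<in> time_nodes G T" if "\<omega> \<in> set_pmf q'" for \<omega>
      using path[OF that] by (auto simp: Path_time_graph)
    have p: "p \<in> time_plans G T \<Gamma>"
      using nodes start finish \<gamma>(1) \<open>project_plan p = \<gamma>\<close>
      by (simp add: time_plans_def distributions_def p_def set_transport_plan time_nodes_def
          image_subset_iff mem_Times_iff)
    have tight: "\<omega> \<in> Geod (time_graph G T) \<xi>"
      "time_dist (hd \<omega>) (last \<omega>) \<le> omega_dist (hd \<omega>) (fst (last \<omega>), Omega)"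
      if "\<omega> \<in> set_pmf q'" for \<omega>
      using extend_path_in_Geod_iff[OF path(1)[OF that] finish[OF that]] that geod by auto
    \<comment> \<open>Tightness bounds the cost of \<open>p\<close> by that of its projection;
      optimality then passes to the projection of \<gamma>', and projecting never raises the
      cost.\<close>
    have "?C p \<le> ?C \<gamma>'" if \<gamma>': "\<gamma>' \<in> time_plans G T \<Gamma>" for \<gamma>'
    proof -
      have "?C p \<le> ?CO (embed_plan (project_plan p))"
        using tight(2) by (intro transport_cost_le_project[OF p]) (auto simp: p_def set_transport_plan)
      also have "\<dots> \<le> ?CO (embed_plan (project_plan \<gamma>'))"
        using opt[of "project_plan \<gamma>'"] \<gamma>' by (simp add: p_eq time_plans_def)
      also have "\<dots> \<le> ?C \<gamma>'"
        using \<gamma>' by (rule transport_cost_project_le)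
      finally show ?thesis .
    qed
    then show "q' \<in> WE (time_graph G T) (time_plans G T \<Gamma>) g"
      using p tight(1) unfolding WE_time by blast
  qed
qed

end
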